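(* Let $\mathcal{T}_4$ and $\mathcal{T}_5$ be the sets of Wang tiles listed in the context, $\Omega_4=\Omega_{\mathcal{T}_4}$, $\Omega_5=\Omega_{\mathcal{T}_5}$, and $X_4=\jmath(\Omega_5)\subseteq\Omega_4$, where $\jmath$ replaces, in every tile of a tiling, the top and bottom colors $5$ by $1$ and $6$ by $0$. Then the set $\Omega_4\setminus X_4$ is nonempty.
   Context: A Wang tile is a tuple $(a,b,c,d)$ giving the colors of the right, top, left and bottom edges of a unit square, in this order. For a finite set $\mathcal{T}$ of Wang tiles, the Wang shift $\Omega_{\mathcal T}$ is the set of all $x:\mathbb{Z}^2\to\mathcal{T}$ such that for every $\mathbf n$ the right color of $x(\mathbf n)$ equals the left color of $x(\mathbf n+\mathbf e_1)$ and the top color of $x(\mathbf n)$ equals the bottom color of $x(\mathbf n+\mathbf e_2)$. $\mathcal{T}_4$ (28 tiles; colors are words over digits): (2113,1,2130,1), (2130,1,2103,1), (2133,1,2113,1), (2113,1,2330,0), (2130,0,2300,0), (2103,1,2310,0), (2310,1,2033,0), (2300,1,2033,0), (2300,0,2030,0), (2030,1,2103,0), (2033,1,2113,0), (2330,1,2133,0), (2330,0,2130,0), (21113,1,21330,1), (21130,0,21300,1), (21103,1,21310,1), (21310,1,21033,1), (21310,0,21030,1), (21300,1,21033,1), (21300,0,21030,1), (21030,1,21103,1), (21033,1,21113,1), (21330,0,21130,1), (21130,0,23300,0), (21030,0,23100,0), (23100,0,20330,0), (20330,0,21130,0), (23300,0,21330,0). $\mathcal{T}_5$ (29 tiles): (2113,5,2130,1),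 (2130,1,2103,5), (2133,1,2113,1), (2113,5,2330,0), (2130,6,2300,0), (2103,5,2310,0), (2310,1,2033,6), (2300,1,2033,6), (2300,0,2030,6), (2030,1,2103,0), (2033,1,2113,0), (2330,1,2133,6), (2330,0,2130,6), (21113,5,21330,1), (21130,6,21300,1), (21103,5,21310,1), (21310,1,21033,5), (21310,0,21030,5), (21300,1,21033,5), (21300,0,21030,5), (21030,1,21103,1), (21033,1,21113,1), (21330,0,21130,1), (21330,0,21130,5), (21130,6,23300,0), (21030,6,23100,0), (23100,0,20330,6), (20330,0,21130,0), (23300,0,21330,6). *)

theory Defs
  imports Main
begin

text \<open>
  A Wang tile is a tuple of edge colors in the order right, top, left, bottom.
\<close>

type_synonym 'c wang_tile = "'c \<times> 'c \<times> 'c \<times> 'c"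

fun right_color :: "'c wang_tile \<Rightarrow> 'c" where "right_color (a, b, c, d) = a"
fun top_color :: "'c wang_tile \<Rightarrow> 'c" where "top_color (a, b, c, d) = b"
fun left_color :: "'c wang_tile \<Rightarrow> 'c" where "left_color (a, b, c, d) = c"
fun bottom_color :: "'c wang_tile \<Rightarrow> 'c" where "bottom_color (a, b, c, d) = d"

definition wang_shift :: "'c wang_tile set \<Rightarrow> (int \<times> int \<Rightarrow> 'c wang_tile) set" where
  "wang_shift T = {x. (\<forall>p. x p \<in> T) \<and>
     (\<forall>m n. right_color (x (m, n)) = left_color (x (m + 1, n))) \<and>
     (\<forall>m n. top_color (x (m, n)) = bottom_color (x (m, n + 1)))}"

text \<open>Colors are words over the decimal digits.\<close>

definition T4 :: "string wang_tile set" where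
  "T4 = {
    (''2113'', ''1'', ''2130'', ''1''), (''2130'', ''1'', ''2103'', ''1''),
    (''2133'', ''1'', ''2113'', ''1''), (''2113'', ''1'', ''2330'', ''0''),
    (''2130'', ''0'', ''2300'', ''0''), (''2103'', ''1'', ''2310'', ''0''),
    (''2310'', ''1'', ''2033'', ''0''), (''2300'', ''1'', ''2033'', ''0''),
    (''2300'', ''0'', ''2030'', ''0''), (''2030'', ''1'', ''2103'', ''0''),
    (''2033'', ''1'', ''2113'', ''0''), (''2330'', ''1'', ''2133'', ''0''),
    (''2330'', ''0'', ''2130'', ''0''), (''21113'', ''1'', ''21330'', ''1''),
    (''21130'', ''0'', ''21300'', ''1''), (''21103'', ''1'', ''21310'', ''1''),
    (''21310'', ''1'', ''21033'', ''1''), (''21310'', ''0'', ''21030'', ''1''),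
    (''21300'', ''1'', ''21033'', ''1''), (''21300'', ''0'', ''21030'', ''1''),
    (''21030'', ''1'', ''21103'', ''1''), (''21033'', ''1'', ''21113'', ''1''),
    (''21330'', ''0'', ''21130'', ''1''), (''21130'', ''0'', ''23300'', ''0''),
    (''21030'', ''0'', ''23100'', ''0''), (''23100'', ''0'', ''20330'', ''0''),
    (''20330'', ''0'', ''21130'', ''0''), (''23300'', ''0'', ''21330'', ''0'')}"

definition T5 :: "string wang_tile set" where
  "T5 = {
    (''2113'', ''5'', ''2130'', ''1''), (''2130'', ''1'', ''2103'', ''5''),
    (''2133'', ''1'', ''2113'', ''1''), (''2113'', ''5'', ''2330'', ''0''),
    (''2130'', ''6'', ''2300'', ''0''), (''2103'', ''5'', ''2310'', ''0''),
    (''2310'', ''1'', ''2033'', ''6''), (''2300'', ''1'', ''2033'', ''6''),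
    (''2300'', ''0'', ''2030'', ''6''), (''2030'', ''1'', ''2103'', ''0''),
    (''2033'', ''1'', ''2113'', ''0''), (''2330'', ''1'', ''2133'', ''6''),
    (''2330'', ''0'', ''2130'', ''6''), (''21113'', ''5'', ''21330'', ''1''),
    (''21130'', ''6'', ''21300'', ''1''), (''21103'', ''5'', ''21310'', ''1''),
    (''21310'', ''1'', ''21033'', ''5''), (''21310'', ''0'', ''21030'', ''5''),
    (''21300'', ''1'', ''21033'', ''5''), (''21300'', ''0'', ''21030'', ''5''),
    (''21030'', ''1'', ''21103'', ''1''), (''21033'', ''1'', ''21113'', ''1''),
    (''21330'', ''0'', ''21130'', ''1''), (''21330'', ''0'', ''21130'', ''5''),
    (''21130'', ''6'', ''23300'', ''0''), (''21030'', ''6'', ''23100'', ''0''),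
    (''23100'', ''0'', ''20330'', ''6''), (''20330'', ''0'', ''21130'', ''0''),
    (''23300'', ''0'', ''21330'', ''6'')}"

definition Omega4 :: "(int \<times> int \<Rightarrow> string wang_tile) set" where
  "Omega4 = wang_shift T4"

definition Omega5 :: "(int \<times> int \<Rightarrow> string wang_tile) set" where
  "Omega5 = wang_shift T5"

definition recolor :: "string \<Rightarrow> string" where
  "recolor w = (if w = ''5'' then ''1'' else if w = ''6'' then ''0'' else w)"

fun jtile :: "string wang_tile \<Rightarrow> string wang_tile" where
  "jtile (a, b, c, d) = (a, recolor b, c, recolor d)"

definition jmap ::
  "(int \<times> int \<Rightarrow> string wang_tile) \<Rightarrow> (int \<times> int \<Rightarrow> string wang_tile)" where
  "jmap x = (\<lambda>p. jtile (x p))"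

definition X4 :: "(int \<times> int \<Rightarrow> string wang_tile) set" where
  "X4 = jmap ` Omega5"

lemma card_T4: "card T4 = 28"
  by (simp add: T4_def)

lemma card_T5: "card T5 = 29"
  by (simp add: T5_def)

lemma jtile_T5: "jtile ` T5 = T4"
  unfolding T4_def T5_def by (simp add: recolor_def insert_commute)

lemma jtile_colors:
  "right_color (jtile t) = right_color t"
  "left_color (jtile t) = left_color t"
  "top_color (jtile t) = recolor (top_color t)"
  "bottom_color (jtile t) = recolor (bottom_color t)"
  by (cases t; simp)+

lemma X4_subset_Omega4: "X4 \<subseteq> Omega4"
  unfolding X4_def Omega4_def Omega5_def wang_shift_def jmap_def
  by (auto simp: jtile_colors jtile_T5[symmetric])

end

theory Submission
  imports Defs Complex_Main
begin

text \<open>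
  The rows of the tiling code the rotation by the golden number \<open>\<theta>\<close> on the circle \<open>[0, 1)\<close>: the
  horizontal edges of row \<open>n\<close> carry the letter \<open>1\<close> on a union of three intervals of total length
  \<open>d = frac (n * \<theta>)\<close>, and the tile at column \<open>m\<close> is read off from the position of
  \<open>frac ((m - n) * \<theta>)\<close> in a partition of the circle whose endpoints are affine in \<open>d\<close>.
  In row \<open>0\<close> the three intervals are empty, so the bottom edges of this row are all \<open>0\<close>, and the upper
  half-plane can be slid along this fault line without leaving \<open>Omega4\<close>. Lifted to \<open>T5\<close>, however,
  the fault line carries a non-constant word over \<open>0\<close> and \<open>6\<close> that is determined by either half-plane,
  and after sliding by one step the two words disagree at column \<open>0\<close>.
\<close>

section \<open>The golden number and its circle rotation\<close>

definition golden :: real ("\<theta>") where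
  "\<theta> = (sqrt 5 - 1) / 2"

lemma golden_square: "\<theta> * \<theta> = 1 - \<theta>"
  by (simp add: golden_def field_simps)

lemma golden_lower: "\<theta> > 61803 / 100000"
proof -
  have "sqrt 5 > 223606 / 100000"
    by (rule real_less_rsqrt) (simp add: power2_eq_square)
  then show ?thesis by (simp add: golden_def)
qed

lemma golden_upper: "\<theta> < 61804 / 100000"
proof -
  have "sqrt 5 < 223608 / 100000"
    by (rule real_less_lsqrt) (simp_all add: power2_eq_square)
  then show ?thesis by (simp add: golden_def)
qed

lemmas golden_bounds = golden_lower golden_upper

text \<open>Rotation of [0, 1) by \<open>\<theta>\<close>; \<open>wrap_sub\<close> is its inverse.
  The piecewise form, without \<open>frac\<close>, suits linear arithmetic.\<close>

definition wrap_add :: "real \<Rightarrow> real" where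
  "wrap_add t = (if t < 1 - \<theta> then t + \<theta> else t - (1 - \<theta>))"

definition wrap_sub :: "real \<Rightarrow> real" where
  "wrap_sub t = (if t < \<theta> then t + (1 - \<theta>) else t - \<theta>)"

text \<open>On the circle the intervals end at \<open>\<theta>\<close>, 0 and
  \<open>- \<theta>\<close>. Their total length \<open>2 * v + w\<close> is \<open>d\<close>, since
  \<open>2 * \<theta>\<^sup>2 + \<theta>\<^sup>3 = 1\<close>.\<close>

definition edge_bit :: "real \<Rightarrow> real \<Rightarrow> real \<Rightarrow> string" where
  "edge_bit v w t = (if \<theta> - w \<le> t \<and> t < \<theta> \<or> 1 - v \<le> t \<or> 1 - \<theta> - v \<le> t \<and> t < 1 - \<theta> then ''1'' else ''0'')"

text \<open>
  Here \<open>v\<close> and \<open>w\<close> stand for \<open>\<theta>\<^sup>2 * d\<close> and \<open>\<theta>\<^sup>3 * d\<close>. Keeping both as variables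
  makes all comparisons linear; the hypotheses on \<open>v - w = \<theta>\<^sup>4 * d\<close> and \<open>2 * w - v = \<theta>\<^sup>5 * d\<close> below
  retain enough of the relation \<open>w = \<theta> * v\<close> for linear arithmetic to order the endpoints.
  Short rows, with colors of length four, occur for \<open>d < \<theta>\<^sup>2\<close>, and long rows otherwise.
\<close>

definition short_tile :: "real \<Rightarrow> real \<Rightarrow> real \<Rightarrow> string wang_tile" where
  "short_tile v w t =
    (if t < 5 * \<theta> - 3 - w then (''2300'', ''0'', ''2030'', ''0'')
     else if t < 2 - 3 * \<theta> - v then (''2300'', ''1'', ''2033'', ''0'')
     else if t < 2 * \<theta> - 1 - w then (''2310'', ''1'', ''2033'', ''0'')
     else if t < 2 * \<theta> - 1 then (''2330'', ''1'', ''2133'', ''0'')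
     else if t < 1 - \<theta> - v then (''2330'', ''0'', ''2130'', ''0'')
     else if t < 1 - \<theta> then (''2130'', ''1'', ''2103'', ''1'')
     else if t < 4 * \<theta> - 2 - w then (''2030'', ''1'', ''2103'', ''0'')
     else if t < \<theta> - w then (''2033'', ''1'', ''2113'', ''0'')
     else if t < \<theta> then (''2133'', ''1'', ''2113'', ''1'')
     else if t < 2 - 2 * \<theta> - v then (''2130'', ''0'', ''2300'', ''0'')
     else if t < 3 * \<theta> - 1 - w then (''2103'', ''1'', ''2310'', ''0'')
     else if t < 1 - v then (''2113'', ''1'', ''2330'', ''0'')
     else (''2113'', ''1'', ''2130'', ''1''))"

definition long_tile :: "real \<Rightarrow> real \<Rightarrow> real \<Rightarrow> string wang_tile" where
  "long_tile v w t =
    (if t < 2 * \<theta> - 1 - w then (''23100'', ''0'', ''20330'', ''0'')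
     else if t < 1 - \<theta> - v then (''23300'', ''0'', ''21330'', ''0'')
     else if t < 7 * \<theta> - 4 - w then (''21300'', ''0'', ''21030'', ''1'')
     else if t < 3 - 4 * \<theta> - v \<and> t < 2 * \<theta> - 1 then (''21300'', ''1'', ''21033'', ''1'')
     else if t < 2 * \<theta> - 1 then (''21310'', ''1'', ''21033'', ''1'')
     else if t < 3 - 4 * \<theta> - v then (''21300'', ''0'', ''21030'', ''1'')
     else if t < 4 * \<theta> - 2 - w then (''21310'', ''0'', ''21030'', ''1'')
     else if t < 1 - \<theta> then (''21330'', ''0'', ''21130'', ''1'')
     else if t < \<theta> - w then (''20330'', ''0'', ''21130'', ''0'')
     else if t < 2 - 2 * \<theta> - v then (''21330'', ''0'', ''21130'', ''1'')
     else if t < 6 * \<theta> - 3 - w then (''21030'', ''1'', ''21103'', ''1'')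
     else if t < \<theta> then (''21033'', ''1'', ''21113'', ''1'')
     else if t < 3 * \<theta> - 1 - w then (''21030'', ''0'', ''23100'', ''0'')
     else if t < 1 - v then (''21130'', ''0'', ''23300'', ''0'')
     else if t < 3 - 3 * \<theta> - v then (''21130'', ''0'', ''21300'', ''1'')
     else if t < 5 * \<theta> - 2 - w then (''21103'', ''1'', ''21310'', ''1'')
     else (''21113'', ''1'', ''21330'', ''1''))"

lemma short_tile_in_T4: "short_tile v w t \<in> T4"
  by (simp add: short_tile_def T4_def)

lemma long_tile_in_T4: "long_tile v w t \<in> T4"
  by (simp add: long_tile_def T4_def)

context
  fixes v w t :: real
  assumes t: "0 \<le> t" "t < 1"
begin

text \<open>The upper bounds are \<open>\<theta>\<^sup>4\<close> to \<open>\<theta>\<^sup>7\<close>,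
  made linear by \<open>golden_square\<close>: they express
  \<open>d < \<theta>\<^sup>2\<close>.\<close>

context
  assumes short:
    "0 \<le> v" "0 \<le> w" "0 \<le> v - w" "0 \<le> 2 * w - v"
    "v < 2 - 3 * \<theta>" "w < 5 * \<theta> - 3" "v - w < 5 - 8 * \<theta>" "2 * w - v < 13 * \<theta> - 8"
begin

lemma short_right_left:
  "right_color (short_tile v w t) = left_color (short_tile v w (wrap_add t))"
  using t short golden_bounds
  by (simp add: short_tile_def wrap_add_def)

lemma short_bottom: "bottom_color (short_tile v w t) = edge_bit v w t"
  using t short golden_bounds
  by (simp add: short_tile_def edge_bit_def)

text \<open>The next row has parameter \<open>d + \<theta>\<close>, so \<open>v\<close> and
  \<open>w\<close> grow by \<open>\<theta>\<^sup>3\<close> and \<open>\<theta>\<^sup>4\<close>. One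
  step up lowers \<open>m - n\<close> by one, hence \<open>wrap_sub\<close>.\<close>

lemma short_top:
  "top_color (short_tile v w t) = edge_bit (v + 2 * \<theta> - 1) (w + 2 - 3 * \<theta>) (wrap_sub t)"
  using t short golden_bounds
  by (simp add: short_tile_def edge_bit_def wrap_sub_def)

end

text \<open>Now \<open>d\<close> runs from \<open>\<theta>\<^sup>2\<close> to 1, so the lower bounds
  are \<open>\<theta>\<^sup>4\<close> to \<open>\<theta>\<^sup>7\<close> and the upper ones
  \<open>\<theta>\<^sup>2\<close> to \<open>\<theta>\<^sup>5\<close>.\<close>

context
  assumes long:
    "2 - 3 * \<theta> \<le> v" "5 * \<theta> - 3 \<le> w" "5 - 8 * \<theta> \<le> v - w" "13 * \<theta> - 8 \<le> 2 * w - v"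
    "v < 1 - \<theta>" "w < 2 * \<theta> - 1" "v - w < 2 - 3 * \<theta>" "2 * w - v < 5 * \<theta> - 3"
begin

lemma long_right_left:
  "right_color (long_tile v w t) = left_color (long_tile v w (wrap_add t))"
  using t long golden_bounds
  by (simp add: long_tile_def wrap_add_def)

lemma long_bottom: "bottom_color (long_tile v w t) = edge_bit v w t"
  using t long golden_bounds
  by (simp add: long_tile_def edge_bit_def)

text \<open>Here \<open>d + \<theta>\<close> wraps around to \<open>d - \<theta>\<^sup>2\<close>, so
  \<open>v\<close> and \<open>w\<close> drop by \<open>\<theta>\<^sup>4\<close> and
  \<open>\<theta>\<^sup>5\<close>.\<close>

lemma long_top:
  "top_color (long_tile v w t) = edge_bit (v + 3 * \<theta> - 2) (w + 3 - 5 * \<theta>) (wrap_sub t)"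
  using t long golden_bounds
  by (simp add: long_tile_def edge_bit_def wrap_sub_def)

end

end

section \<open>Rows indexed by the parameter \<open>d\<close>\<close>

definition edge :: "real \<Rightarrow> real \<Rightarrow> string" where
  "edge d = edge_bit ((1 - \<theta>) * d) ((2 * \<theta> - 1) * d)"

definition tile_at :: "real \<Rightarrow> real \<Rightarrow> string wang_tile" where
  "tile_at d = (if d < 1 - \<theta> then short_tile else long_tile) ((1 - \<theta>) * d) ((2 * \<theta> - 1) * d)"

lemma short_range:
  assumes "0 \<le> d" "d < 1 - \<theta>"
  defines "v \<equiv> (1 - \<theta>) * d" and "w \<equiv> (2 * \<theta> - 1) * d"
  shows "0 \<le> v" "0 \<le> w" "0 \<le> v - w" "0 \<le> 2 * w - v"
    "v < 2 - 3 * \<theta>" "w < 5 * \<theta> - 3" "v - w < 5 - 8 * \<theta>" "2 * w - v < 13 * \<theta> - 8"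
proof -
  \<comment> \<open>For \<open>c\<close> equal to \<open>\<theta>\<^sup>2\<close>,
    \<open>\<theta>\<^sup>3\<close>, \<open>\<theta>\<^sup>4\<close>,
    \<open>\<theta>\<^sup>5\<close>, the product \<open>c * d\<close> is \<open>v\<close>,
    \<open>w\<close>, \<open>v - w\<close>, \<open>2 * w - v\<close>.\<close>
  have *: "0 \<le> c * d \<and> c * d < c * (1 - \<theta>)" if "0 < c" for c
    using that assms by simp
  show "0 \<le> v" "0 \<le> w" "0 \<le> v - w" "0 \<le> 2 * w - v"
    "v < 2 - 3 * \<theta>" "w < 5 * \<theta> - 3" "v - w < 5 - 8 * \<theta>" "2 * w - v < 13 * \<theta> - 8"
    using *[of "1 - \<theta>"] *[of "2 * \<theta> - 1"] *[of "2 - 3 * \<theta>"] *[of "5 * \<theta> - 3"]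
      golden_bounds golden_square
    by (simp_all add: v_def w_def algebra_simps)
qed

lemma long_range:
  assumes "1 - \<theta> \<le> d" "d < 1"
  defines "v \<equiv> (1 - \<theta>) * d" and "w \<equiv> (2 * \<theta> - 1) * d"
  shows "2 - 3 * \<theta> \<le> v" "5 * \<theta> - 3 \<le> w" "5 - 8 * \<theta> \<le> v - w" "13 * \<theta> - 8 \<le> 2 * w - v"
    "v < 1 - \<theta>" "w < 2 * \<theta> - 1" "v - w < 2 - 3 * \<theta>" "2 * w - v < 5 * \<theta> - 3"
proof -
  have *: "c * (1 - \<theta>) \<le> c * d \<and> c * d < c" if "0 < c" for c
    using that assms by simp
  show "2 - 3 * \<theta> \<le> v" "5 * \<theta> - 3 \<le> w" "5 - 8 * \<theta> \<le> v - w" "13 * \<theta> - 8 \<le> 2 * w - v"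
    "v < 1 - \<theta>" "w < 2 * \<theta> - 1" "v - w < 2 - 3 * \<theta>" "2 * w - v < 5 * \<theta> - 3"
    using *[of "1 - \<theta>"] *[of "2 * \<theta> - 1"] *[of "2 - 3 * \<theta>"] *[of "5 * \<theta> - 3"]
      golden_bounds golden_square
    by (simp_all add: v_def w_def algebra_simps)
qed

lemma tile_at_in_T4: "tile_at d t \<in> T4"
  by (simp add: tile_at_def short_tile_in_T4 long_tile_in_T4)

lemma tile_at_right_left:
  assumes "0 \<le> d" "d < 1" "0 \<le> t" "t < 1"
  shows "right_color (tile_at d t) = left_color (tile_at d (wrap_add t))"
  using assms short_right_left[OF _ _ short_range] long_right_left[OF _ _ long_range]
  by (simp add: tile_at_def)

lemma tile_at_bottom:
  assumes "0 \<le> d" "d < 1" "0 \<le> t" "t < 1"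
  shows "bottom_color (tile_at d t) = edge d t"
  using assms short_bottom[OF _ _ short_range] long_bottom[OF _ _ long_range]
  by (simp add: tile_at_def edge_def)

lemma tile_at_top:
  assumes "0 \<le> d" "d < 1" "0 \<le> t" "t < 1"
  shows "top_color (tile_at d t) = edge (wrap_add d) (wrap_sub t)"
proof (cases "d < 1 - \<theta>")
  case True
  have "(1 - \<theta>) * (d + \<theta>) = (1 - \<theta>) * d + 2 * \<theta> - 1"
    "(2 * \<theta> - 1) * (d + \<theta>) = (2 * \<theta> - 1) * d + 2 - 3 * \<theta>"
    using golden_square by (simp_all add: algebra_simps)
  then show ?thesis
    using assms True short_top[OF _ _ short_range]
    by (simp add: tile_at_def edge_def wrap_add_def)
next
  case False
  have "(1 - \<theta>) * (d - (1 - \<theta>)) = (1 - \<theta>) * d + 3 * \<theta> - 2"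
    "(2 * \<theta> - 1) * (d - (1 - \<theta>)) = (2 * \<theta> - 1) * d + 3 - 5 * \<theta>"
    using golden_square by (simp_all add: algebra_simps)
  then show ?thesis
    using assms False long_top[OF _ _ long_range]
    by (simp add: tile_at_def edge_def wrap_add_def)
qed

section \<open>The slid tiling of the plane\<close>

lemma frac_add_golden: "frac (x + \<theta>) = wrap_add (frac x)"
proof -
  have "frac \<theta> = \<theta>"
    using golden_bounds by (simp add: frac_eq)
  then show ?thesis
    by (simp add: frac_add wrap_add_def)
qed

lemma frac_diff_golden: "frac (x - \<theta>) = wrap_sub (frac x)"
proof -
  have "frac (1 - \<theta>) = 1 - \<theta>"
    using golden_bounds by (simp add: frac_eq)
  moreover have "frac (x - \<theta>) = frac (x + (1 - \<theta>))"
    using frac_1_eq[of "x - \<theta>"] by (simp add: algebra_simps)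
  ultimately show ?thesis
    by (simp add: frac_add wrap_sub_def)
qed

lemma edge_0: "t < 1 \<Longrightarrow> edge 0 t = ''0''"
  by (simp add: edge_def edge_bit_def)

text \<open>The summand 1 in rows \<open>n \<ge> 0\<close> is the slide of the upper
  half-plane.\<close>

definition slid_tiling :: "int \<times> int \<Rightarrow> string wang_tile" where
  "slid_tiling = (\<lambda>(m, n). tile_at (frac (of_int n * \<theta>))
     (frac (of_int (m - n + (if 0 \<le> n then 1 else 0)) * \<theta>)))"

lemma slid_tiling_in_Omega4: "slid_tiling \<in> Omega4"
proof -
  have "right_color (slid_tiling (m, n)) = left_color (slid_tiling (m + 1, n))" for m n
  proof -
    let ?s = "of_int (m - n + (if 0 \<le> n then 1 else 0)) * \<theta>"
    have "of_int (m + 1 - n + (if 0 \<le> n then 1 else 0)) * \<theta> = ?s + \<theta>"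
      by (simp add: algebra_simps)
    then show ?thesis
      unfolding slid_tiling_def prod.case
      by (simp only: frac_add_golden) (simp add: tile_at_right_left frac_lt_1)
  qed
  moreover have "top_color (slid_tiling (m, n)) = bottom_color (slid_tiling (m, n + 1))" for m n
  proof -
    let ?s = "\<lambda>n. of_int (m - n + (if 0 \<le> n then 1 else 0)) * \<theta>"
    have top: "top_color (slid_tiling (m, n)) = edge (frac (of_int (n + 1) * \<theta>)) (frac (?s n - \<theta>))"
      unfolding slid_tiling_def prod.case
      by (simp add: tile_at_top frac_lt_1 frac_diff_golden distrib_right flip: frac_add_golden)
    have bottom: "bottom_color (slid_tiling (m, n + 1)) = edge (frac (of_int (n + 1) * \<theta>)) (frac (?s (n + 1)))"
      unfolding slid_tiling_def prod.case
      by (rule tile_at_bottom) (simp_all add: frac_lt_1)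
    show ?thesis
    proof (cases "n = -1")
      \<comment> \<open>At the fault line both edges come from \<open>edge 0\<close>, so the jump in
        position is invisible; elsewhere both rows lie in the same half-plane.\<close>
      case True
      then show ?thesis
        unfolding top bottom by (simp add: edge_0 frac_lt_1)
    next
      case False
      then have "?s (n + 1) = ?s n - \<theta>"
        by (simp add: algebra_simps)
      then show ?thesis
        unfolding top bottom by simp
    qed
  qed
  ultimately show ?thesis
    by (auto simp: Omega4_def wang_shift_def slid_tiling_def tile_at_in_T4)
qed

lemma slid_tiling_at_fault_line:
  "slid_tiling (0, -1) = (''21030'', ''0'', ''23100'', ''0'')"
  "slid_tiling (0, 0) = (''2130'', ''0'', ''2300'', ''0'')"
proof -
  have "frac \<theta> = \<theta>"
    using golden_bounds by (simp add: frac_eq)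
  moreover have "frac (- \<theta>) = 1 - \<theta>"
    using frac_1_eq[of "- \<theta>"] golden_bounds by (simp add: frac_eq)
  \<comment> \<open>These are \<open>v\<close> and \<open>w\<close> in row -1, where
    \<open>d = 1 - \<theta>\<close> is just long. Both tiles sit at position
    \<open>\<theta>\<close>: below the fault line because \<open>m - n = 1\<close>, above it because
    of the slide.\<close>
  moreover have "(1 - \<theta>) * (1 - \<theta>) = 2 - 3 * \<theta>" "(2 * \<theta> - 1) * (1 - \<theta>) = 5 * \<theta> - 3"
    using golden_square by (simp_all add: algebra_simps)
  ultimately show "slid_tiling (0, -1) = (''21030'', ''0'', ''23100'', ''0'')"
    "slid_tiling (0, 0) = (''2130'', ''0'', ''2300'', ''0'')"
    using golden_bounds
    by (simp_all add: slid_tiling_def tile_at_def short_tile_def long_tile_def)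
qed

text \<open>\<open>jtile\<close> keeps left and right colors, and each of these two left-right pairs
  occurs in exactly one tile of \<open>T5\<close>.\<close>

lemma T5_lift:
  assumes "t \<in> T5"
  shows "jtile t = (''21030'', ''0'', ''23100'', ''0'') \<Longrightarrow> top_color t = ''6''"
    and "jtile t = (''2130'', ''0'', ''2300'', ''0'') \<Longrightarrow> bottom_color t = ''0''"
  using assms unfolding T5_def by (auto simp: recolor_def)

theorem proposition35: "Omega4 - X4 \<noteq> {}"
proof -
  have "slid_tiling \<notin> X4"
  proof
    assume "slid_tiling \<in> X4"
    then obtain z where z: "z \<in> Omega5" and eq: "slid_tiling = jmap z"
      by (auto simp: X4_def)
    have jtile: "jtile (z p) = slid_tiling p" for p
      by (simp only: eq jmap_def)
    have T5: "z p \<in> T5" for p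
      using z by (simp add: Omega5_def wang_shift_def del: split_paired_All)
    have "\<forall>m n. top_color (z (m, n)) = bottom_color (z (m, n + 1))"
      using z by (simp add: Omega5_def wang_shift_def)
    from this[rule_format, of 0 "-1"]
    have "top_color (z (0, -1)) = bottom_color (z (0, 0))"
      by simp
    moreover have "top_color (z (0, -1)) = ''6''"
      using T5 by (rule T5_lift) (simp add: jtile slid_tiling_at_fault_line)
    moreover have "bottom_color (z (0, 0)) = ''0''"
      using T5 by (rule T5_lift) (simp add: jtile slid_tiling_at_fault_line)
    ultimately show False
      by simp
  qed
  then show ?thesis
    using slid_tiling_in_Omega4 by blast
qed

end
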